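(* Let $\Omega\subset\mathbb{R}^n$ be a domain. Then the following are equivalent: (1) $\Omega$ is an $(\epsilon,\delta)$-domain for some $\epsilon,\delta>0$; (2) $\Omega$ is a locally distance uniform domain; (3) $\Omega$ is a locally uniform domain.
   Context: A domain is a nonempty open connected set. $d_\Omega(z)=\mathrm{dist}(z,\partial\Omega)$ (with $d_\Omega\equiv+\infty$ if $\Omega=\mathbb{R}^n$). For a rectifiable curve $\gamma$, $s(\gamma)$ denotes its arclength; $\gamma(p,q)$ denotes the portion of $\gamma$ between two of its points $p,q$. $\Omega$ is an $(\epsilon,\delta)$-domain if for all distinct $x,y\in\Omega$ with $|x-y|<\delta$ there is a rectifiable curve $\gamma\subset\Omega$ joining $x$ to $y$ such that $s(\gamma)\le\epsilon^{-1}|x-y|$ and $d_\Omega(z)\ge\epsilon\frac{|z-x||z-y|}{|x-y|}$ for all $z\in\gamma$. $\Omega$ is a locally distance uniform domain if there exist $a,b\ge1$ and $\delta>0$ such that for all $x,y\in\Omega$ with $|x-y|<\delta$ there is a rectifiable curve $\gamma\subset\Omega$ connecting $x$ and $y$ with $s(\gamma)\le a|x-y|$ and $\min\{|x-z|,|y-z|\}\le b\,d_\Omega(z)$ for all $z\in\gamma$. $\Omega$ is a locally (length-)uniform domain if there exist $a,b\ge1$ and $\delta>0$ such that for all $x,y\in\Omega$ with $|x-y|<\delta$ there is a rectifiable curve $\gamma\subset\Omega$ connecting $x$ and $y$ with $s(\gamma)\le a|x-y|$ and $\min\{s(\gamma(x,z)),s(\gamma(z,y))\}\le b\,d_\Omega(z)$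 for all $z\in\gamma$. *)

theory Defs
  imports "HOL-Analysis.Analysis"
begin

text \<open>Curves are continuous maps on the unit interval, not necessarily injective, as in
  \<^const>\<open>path\<close>. The value of \<open>arclength \<gamma> u v\<close> is the length of the portion of \<open>\<gamma>\<close> over
  \<open>{u..v}\<close>, for \<open>u \<le> v\<close>: the supremum of the lengths of the inscribed polygons, possibly \<open>\<infinity>\<close>.\<close>

definition arclength :: "(real \<Rightarrow> 'a::metric_space) \<Rightarrow> real \<Rightarrow> real \<Rightarrow> ereal" where
  "arclength \<gamma> u v =
    (SUP (n, t) \<in> {(n::nat, t::nat \<Rightarrow> real). t 0 = u \<and> t n = v \<and> (\<forall>i<n. t i \<le> t (Suc i))}.
      ereal (\<Sum>i<n. dist (\<gamma> (t i)) (\<gamma> (t (Suc i)))))"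

definition rectifiable_path :: "(real \<Rightarrow> 'a::metric_space) \<Rightarrow> bool" where
  "rectifiable_path \<gamma> \<longleftrightarrow> path \<gamma> \<and> arclength \<gamma> 0 1 < \<infinity>"

definition rectifiable_join :: "'a::metric_space set \<Rightarrow> 'a \<Rightarrow> 'a \<Rightarrow> (real \<Rightarrow> 'a) \<Rightarrow> bool" where
  "rectifiable_join \<Omega> x y \<gamma> \<longleftrightarrow>
    rectifiable_path \<gamma> \<and> path_image \<gamma> \<subseteq> \<Omega> \<and> pathstart \<gamma> = x \<and> pathfinish \<gamma> = y"

text \<open>The whole space needs its own case since \<^const>\<open>infdist\<close> is \<open>0\<close> on the empty set.\<close>

definition boundary_dist :: "'a::metric_space set \<Rightarrow> 'a \<Rightarrow> ereal" where
  "boundary_dist \<Omega> z = (if \<Omega> = UNIV then \<infinity> else ereal (infdist z (frontier \<Omega>)))"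

text \<open>The next three predicates are meant for nonempty open connected \<open>\<Omega>\<close>.\<close>

definition eps_delta_domain :: "real \<Rightarrow> real \<Rightarrow> 'a::metric_space set \<Rightarrow> bool" where
  "eps_delta_domain \<epsilon> \<delta> \<Omega> \<longleftrightarrow>
    (\<forall>x\<in>\<Omega>. \<forall>y\<in>\<Omega>. x \<noteq> y \<and> dist x y < \<delta> \<longrightarrow>
      (\<exists>\<gamma>. rectifiable_join \<Omega> x y \<gamma> \<and>
        arclength \<gamma> 0 1 \<le> ereal (inverse \<epsilon> * dist x y) \<and>
        (\<forall>z\<in>path_image \<gamma>.
          boundary_dist \<Omega> z \<ge> ereal (\<epsilon> * (dist z x * dist z y / dist x y)))))"

definition locally_distance_uniform :: "'a::metric_space set \<Rightarrow> bool" where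
  "locally_distance_uniform \<Omega> \<longleftrightarrow>
    (\<exists>a b \<delta> :: real. a \<ge> 1 \<and> b \<ge> 1 \<and> \<delta> > 0 \<and>
      (\<forall>x\<in>\<Omega>. \<forall>y\<in>\<Omega>. dist x y < \<delta> \<longrightarrow>
        (\<exists>\<gamma>. rectifiable_join \<Omega> x y \<gamma> \<and>
          arclength \<gamma> 0 1 \<le> ereal (a * dist x y) \<and>
          (\<forall>z\<in>path_image \<gamma>.
            ereal (min (dist x z) (dist y z)) \<le> ereal b * boundary_dist \<Omega> z))))"

text \<open>The point \<open>z = \<gamma> t\<close> is taken together with its parameter \<open>t\<close>, which fixes the two portions
  of \<open>\<gamma>\<close> from \<open>x\<close> to \<open>z\<close> and from \<open>z\<close> to \<open>y\<close> also where \<open>\<gamma>\<close> is not injective.\<close>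

definition locally_uniform :: "'a::metric_space set \<Rightarrow> bool" where
  "locally_uniform \<Omega> \<longleftrightarrow>
    (\<exists>a b \<delta> :: real. a \<ge> 1 \<and> b \<ge> 1 \<and> \<delta> > 0 \<and>
      (\<forall>x\<in>\<Omega>. \<forall>y\<in>\<Omega>. dist x y < \<delta> \<longrightarrow>
        (\<exists>\<gamma>. rectifiable_join \<Omega> x y \<gamma> \<and>
          arclength \<gamma> 0 1 \<le> ereal (a * dist x y) \<and>
          (\<forall>t\<in>{0..1}.
            min (arclength \<gamma> 0 t) (arclength \<gamma> t 1) \<le> ereal b * boundary_dist \<Omega> (\<gamma> t)))))"

end

theory Submission
  imports Defs
begin

text \<open>Only the step from distance uniformity to length uniformity is not a direct estimate.
  Given \<open>x\<close> and \<open>y\<close>, take a point \<open>w\<close> equidistant from both on a distance uniform curve, so that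
  \<open>w\<close> lies at depth at least \<open>dist x w / b\<close>. A length cigar from \<open>x\<close> to \<open>w\<close> is then built by
  halving: some \<open>w'\<close> on a distance uniform curve from \<open>x\<close> to \<open>w\<close> has \<open>dist x w' = dist x w / 2\<close>, and
  it again has depth at least \<open>dist x w' / b\<close>. A distance uniform curve between the two deep points
  \<open>w'\<close> and \<open>w\<close> stays at depth comparable to \<open>dist x w\<close>, and the lengths of these pieces form a
  geometric series. Since \<open>x\<close> is an interior point, finitely many pieces and a segment suffice.\<close>

section \<open>Arclength\<close>

lemma arclength_leI:
  assumes "\<And>n t. \<lbrakk>t 0 = u; t n = v; \<And>i. i < n \<Longrightarrow> t i \<le> t (Suc i)\<rbrakk>
    \<Longrightarrow> ereal (\<Sum>i<n. dist (\<gamma> (t i)) (\<gamma> (t (Suc i)))) \<le> c"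
  shows "arclength \<gamma> u v \<le> c"
  unfolding arclength_def by (rule SUP_least) (use assms in auto)

lemma arclength_geI:
  assumes "t 0 = u" "t n = v" "\<And>i. i < n \<Longrightarrow> t i \<le> t (Suc i)"
  shows "ereal (\<Sum>i<n. dist (\<gamma> (t i)) (\<gamma> (t (Suc i)))) \<le> arclength \<gamma> u v"
  unfolding arclength_def
  by (rule SUP_upper2[where i = "(n, t)"]) (use assms in auto)

lemma dist_le_arclength:
  assumes "u \<le> v"
  shows "ereal (dist (\<gamma> u) (\<gamma> v)) \<le> arclength \<gamma> u v"
  using arclength_geI[of "\<lambda>i. if i = 0 then u else v" u 1 v \<gamma>] assms by simp

lemma dist_add_dist_le_arclength:
  assumes "u \<le> w" "w \<le> v"
  shows "ereal (dist (\<gamma> u) (\<gamma> w) + dist (\<gamma> w) (\<gamma> v)) \<le> arclength \<gamma> u v"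
  using arclength_geI[of "\<lambda>i. if i = 0 then u else if i = 1 then w else v" u 2 v \<gamma>] assms
  by (simp add: numeral_2_eq_2 less_Suc_eq)

lemma partition_bounds:
  fixes t :: "nat \<Rightarrow> real"
  assumes "\<And>i. i < n \<Longrightarrow> t i \<le> t (Suc i)" and "i \<le> n"
  shows "t 0 \<le> t i" "t i \<le> t n"
proof -
  show "t 0 \<le> t i"
    using assms(2)
  proof (induction i)
    case (Suc i)
    then show ?case
      using assms(1)[of i] by simp
  qed simp
  show "t i \<le> t n"
    using assms(2)
  proof (induction rule: inc_induct)
    case (step i)
    then show ?case
      using assms(1)[of i] by simp
  qed simp
qed

text \<open>Appending the node \<open>v'\<close> to a partition ending at \<open>v\<close> adds one
  nonnegative term to the polygon length.\<close>

lemma arclength_mono_right: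
  assumes "v \<le> v'"
  shows "arclength \<gamma> u v \<le> arclength \<gamma> u v'"
proof (rule arclength_leI)
  fix n :: nat and t :: "nat \<Rightarrow> real"
  assume t: "t 0 = u" "t n = v" "\<And>i. i < n \<Longrightarrow> t i \<le> t (Suc i)"
  \<comment> \<open>The default \<open>v'\<close> beyond \<open>n\<close> matters at index
    \<open>Suc n\<close> only: it creates the single extra step from \<open>v\<close> to
    \<open>v'\<close>.\<close>
  define t' where "t' i = (if i \<le> n then t i else v')" for i
  have "ereal (\<Sum>i<Suc n. dist (\<gamma> (t' i)) (\<gamma> (t' (Suc i)))) \<le> arclength \<gamma> u v'"
    by (rule arclength_geI) (use t assms in \<open>auto simp: t'_def less_Suc_eq\<close>)
  moreover have "(\<Sum>i<n. dist (\<gamma> (t i)) (\<gamma> (t (Suc i)))) =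
      (\<Sum>i<n. dist (\<gamma> (t' i)) (\<gamma> (t' (Suc i))))"
    by (rule sum.cong) (auto simp: t'_def)
  ultimately show "ereal (\<Sum>i<n. dist (\<gamma> (t i)) (\<gamma> (t (Suc i)))) \<le> arclength \<gamma> u v'"
    by (auto intro: order_trans[rotated])
qed

text \<open>Clamping all nodes of a partition at \<open>w\<close>, from above and from below, yields
  partitions of the two portions. There is no need to search for the step that crosses
  \<open>w\<close>.\<close>

lemma arclength_add:
  assumes "u \<le> w" "w \<le> v"
  shows "arclength \<gamma> u v \<le> arclength \<gamma> u w + arclength \<gamma> w v"
proof (rule arclength_leI)
  fix n :: nat and t :: "nat \<Rightarrow> real"
  assume t: "t 0 = u" "t n = v" "\<And>i. i < n \<Longrightarrow> t i \<le> t (Suc i)"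
  let ?l = "\<lambda>i. min (t i) w" and ?r = "\<lambda>i. max (t i) w"
  have "(\<Sum>i<n. dist (\<gamma> (t i)) (\<gamma> (t (Suc i)))) \<le>
      (\<Sum>i<n. dist (\<gamma> (?l i)) (\<gamma> (?l (Suc i))) + dist (\<gamma> (?r i)) (\<gamma> (?r (Suc i))))"
  proof (rule sum_mono)
    fix i assume "i \<in> {..<n}"
    then have "t i \<le> t (Suc i)"
      using t by auto
    \<comment> \<open>On one side of \<open>w\<close> one of the two clamped terms vanishes; a step
      across \<open>w\<close> is the triangle inequality through \<open>\<gamma> w\<close>.\<close>
    then consider "t (Suc i) \<le> w" "t i \<le> w" | "t i \<le> w" "w \<le> t (Suc i)"
      | "w \<le> t i" "w \<le> t (Suc i)"
      by linarith
    then show "dist (\<gamma> (t i)) (\<gamma> (t (Suc i))) \<le>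
        dist (\<gamma> (?l i)) (\<gamma> (?l (Suc i))) + dist (\<gamma> (?r i)) (\<gamma> (?r (Suc i)))"
      by cases (auto simp: min_absorb1 min_absorb2 max_absorb1 max_absorb2 dist_triangle)
  qed
  then have "ereal (\<Sum>i<n. dist (\<gamma> (t i)) (\<gamma> (t (Suc i)))) \<le>
      ereal (\<Sum>i<n. dist (\<gamma> (?l i)) (\<gamma> (?l (Suc i)))) +
      ereal (\<Sum>i<n. dist (\<gamma> (?r i)) (\<gamma> (?r (Suc i))))"
    by (simp add: sum.distrib)
  also have "\<dots> \<le> arclength \<gamma> u w + arclength \<gamma> w v"
  proof (rule add_mono)
    show "ereal (\<Sum>i<n. dist (\<gamma> (?l i)) (\<gamma> (?l (Suc i)))) \<le> arclength \<gamma> u w"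
      by (rule arclength_geI) (use t assms in \<open>auto intro: min.coboundedI1\<close>)
    show "ereal (\<Sum>i<n. dist (\<gamma> (?r i)) (\<gamma> (?r (Suc i)))) \<le> arclength \<gamma> w v"
      by (rule arclength_geI) (use t assms in \<open>auto intro: max.coboundedI1\<close>)
  qed
  finally show "ereal (\<Sum>i<n. dist (\<gamma> (t i)) (\<gamma> (t (Suc i)))) \<le>
      arclength \<gamma> u w + arclength \<gamma> w v" .
qed

text \<open>A monotone map sends partitions to partitions, and the inscribed polygon keeps its
  vertices. This measures the two halves of a joined path.\<close>

lemma arclength_reparam_le:
  assumes "mono_on {u..v} \<phi>" and eq: "\<And>s. s \<in> {u..v} \<Longrightarrow> \<gamma> s = \<eta> (\<phi> s)"
  shows "arclength \<gamma> u v \<le> arclength \<eta> (\<phi> u) (\<phi> v)"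
proof (rule arclength_leI)
  fix n :: nat and t :: "nat \<Rightarrow> real"
  assume t: "t 0 = u" "t n = v" "\<And>i. i < n \<Longrightarrow> t i \<le> t (Suc i)"
  have mem: "t i \<in> {u..v}" if "i \<le> n" for i
    using partition_bounds[of n t i] t that by auto
  have "ereal (\<Sum>i<n. dist (\<eta> (\<phi> (t i))) (\<eta> (\<phi> (t (Suc i))))) \<le> arclength \<eta> (\<phi> u) (\<phi> v)"
    by (rule arclength_geI[where t = "\<lambda>i. \<phi> (t i)"])
      (use t mem in \<open>auto intro!: mono_onD[OF assms(1)]\<close>)
  moreover have "(\<Sum>i<n. dist (\<gamma> (t i)) (\<gamma> (t (Suc i)))) =
      (\<Sum>i<n. dist (\<eta> (\<phi> (t i))) (\<eta> (\<phi> (t (Suc i)))))"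
    by (rule sum.cong) (use mem eq in \<open>auto simp: Suc_le_eq\<close>)
  ultimately show "ereal (\<Sum>i<n. dist (\<gamma> (t i)) (\<gamma> (t (Suc i)))) \<le> arclength \<eta> (\<phi> u) (\<phi> v)"
    by simp
qed

lemma arclength_reversepath_le:
  "arclength (reversepath \<gamma>) u v \<le> arclength \<gamma> (1 - v) (1 - u)"
proof (rule arclength_leI)
  fix n :: nat and t :: "nat \<Rightarrow> real"
  assume t: "t 0 = u" "t n = v" "\<And>i. i < n \<Longrightarrow> t i \<le> t (Suc i)"
  \<comment> \<open>The reflected nodes, listed backwards so that they increase again.\<close>
  let ?t' = "\<lambda>i. 1 - t (n - i)"
  have "ereal (\<Sum>i<n. dist (\<gamma> (?t' i)) (\<gamma> (?t' (Suc i)))) \<le> arclength \<gamma> (1 - v) (1 - u)"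
  proof (rule arclength_geI)
    fix i assume "i < n"
    then show "?t' i \<le> ?t' (Suc i)"
      using t(3)[of "n - Suc i"] by (simp add: Suc_diff_Suc)
  qed (use t in auto)
  moreover have "(\<Sum>i<n. dist (\<gamma> (?t' i)) (\<gamma> (?t' (Suc i)))) =
      (\<Sum>i<n. dist (reversepath \<gamma> (t i)) (reversepath \<gamma> (t (Suc i))))"
    by (subst sum.nat_diff_reindex[symmetric])
      (auto intro!: sum.cong simp: reversepath_def dist_commute Suc_diff_Suc)
  ultimately show "ereal (\<Sum>i<n. dist (reversepath \<gamma> (t i)) (reversepath \<gamma> (t (Suc i)))) \<le>
      arclength \<gamma> (1 - v) (1 - u)"
    by simp
qed

section \<open>Length of concatenations and segments\<close>

lemma arclength_joinpaths_left:
  assumes "0 \<le> s" "s \<le> 1/2"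
  shows "arclength (g +++ h) 0 s \<le> arclength g 0 (2 * s)"
  using arclength_reparam_le[of 0 s "\<lambda>x. 2 * x" "g +++ h" g] assms
  by (auto simp: mono_on_def joinpaths_def)

lemma arclength_joinpaths_right:
  assumes "pathfinish g = pathstart h" "1/2 \<le> s" "s \<le> 1"
  shows "arclength (g +++ h) s 1 \<le> arclength h (2 * s - 1) 1"
proof -
  have "(g +++ h) r = h (2 * r - 1)" if "r \<in> {s..1}" for r
  \<comment> \<open>At the junction \<open>joinpaths\<close> takes its first branch, so the value
    there is the end of \<open>g\<close>, which has to be identified with the start of
    \<open>h\<close>.\<close>
  proof (cases "2 * r = 1")
    case True
    then show ?thesis
      using assms(1) unfolding joinpaths_def True by (simp add: pathfinish_def pathstart_def)
  next
    case False
    then show ?thesis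
      using assms that by (simp add: joinpaths_def)
  qed
  then show ?thesis
    using arclength_reparam_le[of s 1 "\<lambda>x. 2 * x - 1" "g +++ h" h] by (simp add: mono_on_def)
qed

lemma arclength_joinpaths:
  assumes "pathfinish g = pathstart h"
  shows "arclength (g +++ h) 0 1 \<le> arclength g 0 1 + arclength h 0 1"
proof -
  have "arclength (g +++ h) 0 1 \<le> arclength (g +++ h) 0 (1/2) + arclength (g +++ h) (1/2) 1"
    by (rule arclength_add) simp_all
  also have "\<dots> \<le> arclength g 0 1 + arclength h 0 1"
    using arclength_joinpaths_left[of "1/2" g h] arclength_joinpaths_right[OF assms, of "1/2"]
    by (intro add_mono) simp_all
  finally show ?thesis .
qed

lemma arclength_linepath_le:
  fixes x y :: "'a::real_normed_vector"
  shows "arclength (linepath x y) u v \<le> ereal ((v - u) * dist x y)"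
proof (rule arclength_leI)
  fix n :: nat and t :: "nat \<Rightarrow> real"
  assume t: "t 0 = u" "t n = v" "\<And>i. i < n \<Longrightarrow> t i \<le> t (Suc i)"
  have "dist (linepath x y p) (linepath x y q) = \<bar>q - p\<bar> * dist x y" for p q
  proof -
    have "linepath x y p - linepath x y q = (q - p) *\<^sub>R (x - y)"
      by (simp add: linepath_def algebra_simps)
    then show ?thesis
      by (simp add: dist_norm)
  qed
  then have "(\<Sum>i<n. dist (linepath x y (t i)) (linepath x y (t (Suc i)))) =
      (\<Sum>i<n. t (Suc i) - t i) * dist x y"
    unfolding sum_distrib_right by (intro sum.cong) (use t in auto)
  also have "\<dots> = (v - u) * dist x y"
    using t by (simp add: sum_lessThan_telescope)
  finally show "ereal (\<Sum>i<n. dist (linepath x y (t i)) (linepath x y (t (Suc i)))) \<le>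
      ereal ((v - u) * dist x y)"
    by simp
qed

section \<open>Curves of finite length joining two points\<close>

lemma rectifiable_joinI:
  assumes "path \<gamma>" "path_image \<gamma> \<subseteq> \<Omega>" "pathstart \<gamma> = x" "pathfinish \<gamma> = y"
    and "arclength \<gamma> 0 1 \<le> ereal l"
  shows "rectifiable_join \<Omega> x y \<gamma>"
  using assms unfolding rectifiable_join_def rectifiable_path_def
  by (auto intro: le_less_trans)

lemma rectifiable_joinD:
  assumes "rectifiable_join \<Omega> x y \<gamma>"
  shows "path \<gamma>" "path_image \<gamma> \<subseteq> \<Omega>" "pathstart \<gamma> = x" "pathfinish \<gamma> = y"
  using assms unfolding rectifiable_join_def rectifiable_path_def by auto

text \<open>Serves the pair \<open>x = y\<close>, which distance uniformity includes and the
  condition of an \<open>(\<epsilon>, \<delta>)\<close>-domain excludes.\<close>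

lemma rectifiable_join_const:
  assumes "x \<in> \<Omega>"
  shows "rectifiable_join \<Omega> x x (\<lambda>_. x)" "arclength (\<lambda>_. x) u v \<le> 0"
proof -
  show *: "arclength (\<lambda>_. x) u v \<le> 0" for u v
    by (rule arclength_leI) simp
  show "rectifiable_join \<Omega> x x (\<lambda>_. x)"
    by (rule rectifiable_joinI[where l = 0])
      (use assms * in \<open>auto simp: path_def path_image_def pathstart_def pathfinish_def zero_ereal_def\<close>)
qed

text \<open>The polygon from \<open>x\<close> through \<open>z\<close> to \<open>y\<close> is
  inscribed in the curve, so the curve stays in an ellipsoid with foci \<open>x\<close> and
  \<open>y\<close>.\<close>

lemma dist_add_dist_le:
  assumes "rectifiable_join \<Omega> x y \<gamma>" "arclength \<gamma> 0 1 \<le> ereal l" "z \<in> path_image \<gamma>"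
  shows "dist x z + dist z y \<le> l"
proof -
  obtain t where t: "0 \<le> t" "t \<le> 1" "z = \<gamma> t"
    using assms(3) by (auto simp: path_image_def)
  have "ereal (dist x z + dist z y) \<le> arclength \<gamma> 0 1"
    using dist_add_dist_le_arclength[OF t(1,2), of \<gamma>] rectifiable_joinD[OF assms(1)] t(3)
    by (simp add: pathstart_def pathfinish_def)
  also note assms(2)
  finally show ?thesis
    by simp
qed

section \<open>Distance uniform versus length uniform\<close>

lemma boundary_dist_nonneg: "0 \<le> boundary_dist \<Omega> z"
  by (auto simp: boundary_dist_def infdist_nonneg)

lemma ereal_le_times_boundary_dist_iff:
  assumes "b > 0"
  shows "ereal p \<le> ereal b * boundary_dist \<Omega> z \<longleftrightarrow>
    \<Omega> = UNIV \<or> p \<le> b * infdist z (frontier \<Omega>)"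
  using assms by (auto simp: boundary_dist_def)

lemma ereal_le_boundary_dist_iff:
  "ereal p \<le> boundary_dist \<Omega> z \<longleftrightarrow> \<Omega> = UNIV \<or> p \<le> infdist z (frontier \<Omega>)"
  by (auto simp: boundary_dist_def)

text \<open>A ball is connected: if it met both \<open>\<Omega>\<close> and the complement, it would
  contain a frontier point closer to \<open>x\<close> than the distance to the frontier.\<close>

lemma ball_infdist_frontier_subset:
  fixes x :: "'a::real_normed_vector"
  assumes "x \<in> \<Omega>"
  shows "ball x (infdist x (frontier \<Omega>)) \<subseteq> \<Omega>"
proof (rule ccontr)
  assume *: "\<not> ?thesis"
  then obtain z where z: "z \<in> ball x (infdist x (frontier \<Omega>))" "z \<notin> \<Omega>"
    by blast
  then have "0 < infdist x (frontier \<Omega>)"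
    by (auto intro: le_less_trans[OF zero_le_dist])
  then have "ball x (infdist x (frontier \<Omega>)) \<inter> \<Omega> \<noteq> {}"
    using assms by force
  with z have "ball x (infdist x (frontier \<Omega>)) \<inter> frontier \<Omega> \<noteq> {}"
    by (intro connected_Int_frontier) auto
  then show False
    by (force dest: infdist_le[of _ _ x])
qed

lemma infdist_frontier_pos:
  fixes \<Omega> :: "'a::real_normed_vector set"
  assumes "open \<Omega>" "\<Omega> \<noteq> UNIV" "x \<in> \<Omega>"
  shows "0 < infdist x (frontier \<Omega>)"
proof -
  have "frontier \<Omega> \<noteq> {}"
    using assms by (auto simp: frontier_eq_empty)
  moreover have "x \<notin> frontier \<Omega>"
    using assms by (simp add: frontier_def interior_open)
  ultimately show ?thesis
    using infdist_pos_not_in_closed[OF frontier_closed] by blast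
qed

text \<open>Here \<open>k\<close> bounds the number of halvings after which the deep point is so
  close to \<open>x\<close> that a segment suffices. The factor \<open>3 * a\<close> solves the
  recursion \<open>L r = L (r / 2) + a * (3/2 * r)\<close>, and \<open>12 * a * b\<^sup>2\<close> is
  \<open>3 * a\<close> times the depth factor \<open>4 * b\<^sup>2\<close> of the last piece. The
  bound \<open>3/2 * dist x w < \<delta>\<close> makes \<open>curves\<close> applicable to that
  piece.\<close>

lemma length_cigar_halving:
  fixes \<Omega> :: "'a::real_normed_vector set"
  assumes a: "1 \<le> a" and b: "1 \<le> b" and x: "x \<in> \<Omega>"
    and curves: "\<And>x y. \<lbrakk>x \<in> \<Omega>; y \<in> \<Omega>; dist x y < \<delta>\<rbrakk> \<Longrightarrow>
      \<exists>\<gamma>. rectifiable_join \<Omega> x y \<gamma> \<and> arclength \<gamma> 0 1 \<le> ereal (a * dist x y) \<and>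
        (\<forall>z\<in>path_image \<gamma>. min (dist x z) (dist y z) \<le> b * infdist z (frontier \<Omega>))"
    and "w \<in> \<Omega>" "3/2 * dist x w < \<delta>" "dist x w \<le> b * infdist w (frontier \<Omega>)"
      "dist x w \<le> 2 ^ k * (infdist x (frontier \<Omega>) / 2)" "0 < infdist x (frontier \<Omega>)"
  shows "\<exists>\<gamma>. rectifiable_join \<Omega> x w \<gamma> \<and> arclength \<gamma> 0 1 \<le> ereal (3 * a * dist x w) \<and>
    (\<forall>t\<in>{0..1}. arclength \<gamma> 0 t \<le> ereal (12 * a * b\<^sup>2 * infdist (\<gamma> t) (frontier \<Omega>)))"
  using assms(5-)
proof (induction k arbitrary: w)
  case 0
  define d where "d z = infdist z (frontier \<Omega>)" for z
  have lip: "d p \<le> d q + dist p q" for p q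
    unfolding d_def by (rule infdist_triangle)
  have C: "1 \<le> 12 * a * b\<^sup>2"
    using a b mult_mono[of 1 "12 * a" 1 "b\<^sup>2"] by simp
  have len: "arclength (linepath x w) 0 t \<le> ereal (t * dist x w)" for t
    using arclength_linepath_le[of x w 0 t] by simp
  have near: "dist x z \<le> dist x w" if "z \<in> closed_segment x w" for z
    using that segment_bound1[of z x w] by (simp add: dist_norm norm_minus_commute)
  have "dist x w < d x"
    using 0 unfolding d_def by simp
  with near have "closed_segment x w \<subseteq> ball x (d x)"
    by force
  also have "\<dots> \<subseteq> \<Omega>"
    unfolding d_def by (rule ball_infdist_frontier_subset[OF x])
  finally have sub: "closed_segment x w \<subseteq> \<Omega>" .
  have "dist x w \<le> 3 * a * dist x w"
    using a mult_right_mono[of 1 "3 * a" "dist x w"] by simp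
  then have total: "arclength (linepath x w) 0 1 \<le> ereal (3 * a * dist x w)"
    using len[of 1] by (auto intro: order_trans)
  moreover have "rectifiable_join \<Omega> x w (linepath x w)"
    by (rule rectifiable_joinI[OF _ _ _ _ total]) (use sub in auto)
  moreover have "arclength (linepath x w) 0 t \<le> ereal (12 * a * b\<^sup>2 * d (linepath x w t))"
    if t: "t \<in> {0..1}" for t
  proof -
    have z: "linepath x w t \<in> closed_segment x w"
      using t by (metis imageI linepath_image_01)
    have dx: "dist x w \<le> d x / 2"
      using 0 by (simp add: d_def)
    have "t * dist x w \<le> 1 * dist x w"
      using t by (intro mult_right_mono) auto
    \<comment> \<open>The depth of \<open>x\<close> is at least \<open>2 * dist x w\<close>, and
      moving along the segment costs at most \<open>dist x w\<close> of it.\<close>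
    also have "\<dots> \<le> d (linepath x w t)"
      using near[OF z] dx lip[of x "linepath x w t"] by linarith
    also have "\<dots> \<le> 12 * a * b\<^sup>2 * d (linepath x w t)"
      using C mult_right_mono[OF C, of "d (linepath x w t)"]
      by (simp add: d_def infdist_nonneg)
    finally show ?thesis
      using len[of t] by (auto intro: order_trans)
  qed
  ultimately show ?case
    unfolding d_def by blast
next
  case (Suc k)
  define d where "d z = infdist z (frontier \<Omega>)" for z
  define r where "r = dist x w"
  have lip: "d p \<le> d q + dist p q" for p q
    unfolding d_def by (rule infdist_triangle)
  have r0: "0 \<le> r"
    by (simp add: r_def)
  have "dist x w < \<delta>"
    using Suc.prems(2) zero_le_dist[of x w] by linarith
  then obtain \<sigma> where \<sigma>: "rectifiable_join \<Omega> x w \<sigma>"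
    "\<And>z. z \<in> path_image \<sigma> \<Longrightarrow> min (dist x z) (dist w z) \<le> b * d z"
    using curves[OF x Suc.prems(1)] unfolding d_def by blast
  note \<sigma>D = rectifiable_joinD[OF \<sigma>(1)]
  obtain w' where w': "w' \<in> path_image \<sigma>" "dist x w' = r / 2"
  proof -
    have "continuous_on {0..1} (\<lambda>t. dist x (\<sigma> t))"
      using \<sigma>D(1) by (intro continuous_intros) (simp add: path_def)
    then obtain t where "0 \<le> t" "t \<le> 1" "dist x (\<sigma> t) = r / 2"
      using IVT'[of "\<lambda>t. dist x (\<sigma> t)" 0 "r / 2" 1] \<sigma>D(3,4) r0
      by (auto simp: pathstart_def pathfinish_def r_def)
    then show thesis
      by (intro that[of "\<sigma> t"]) (auto simp: path_image_def)
  qed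
  have w'\<Omega>: "w' \<in> \<Omega>"
    using w' \<sigma>D by blast
  have ww': "dist w' w \<le> 3/2 * r" "r / 2 \<le> dist w w'"
    using w'(2) dist_triangle[of x w w'] dist_triangle[of w' w x]
    by (auto simp: r_def dist_commute)
  \<comment> \<open>The distance from \<open>w'\<close> to \<open>x\<close> is \<open>r / 2\<close>
    and that to \<open>w\<close> is no smaller, so the minimum in the cigar condition is
    \<open>r / 2\<close>.\<close>
  have dw': "r / 2 \<le> b * d w'"
    using \<sigma>(2)[OF w'(1)] w'(2) ww'(2) by auto
  have "3/2 * dist x w' < \<delta>" "dist x w' \<le> 2 ^ k * (infdist x (frontier \<Omega>) / 2)"
    using Suc.prems(2,4) w'(2) r0 unfolding r_def power_Suc by linarith+
  then have "\<exists>\<gamma>. rectifiable_join \<Omega> x w' \<gamma> \<and> arclength \<gamma> 0 1 \<le> ereal (3 * a * dist x w') \<and>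
    (\<forall>t\<in>{0..1}. arclength \<gamma> 0 t \<le> ereal (12 * a * b\<^sup>2 * infdist (\<gamma> t) (frontier \<Omega>)))"
    by (intro Suc.IH) (use Suc.prems(5) w' w'\<Omega> dw' in \<open>simp_all add: d_def\<close>)
  then obtain g where g: "rectifiable_join \<Omega> x w' g" "arclength g 0 1 \<le> ereal (3 * a * (r / 2))"
    "\<And>t. t \<in> {0..1} \<Longrightarrow> arclength g 0 t \<le> ereal (12 * a * b\<^sup>2 * d (g t))"
    unfolding d_def w'(2) by blast
  note gD = rectifiable_joinD[OF g(1)]
  have "dist w' w < \<delta>"
    using ww' Suc.prems(2) by (simp add: r_def)
  then obtain \<eta> where \<eta>: "rectifiable_join \<Omega> w' w \<eta>" "arclength \<eta> 0 1 \<le> ereal (a * dist w' w)"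
    "\<And>z. z \<in> path_image \<eta> \<Longrightarrow> min (dist w' z) (dist w z) \<le> b * d z"
    using curves[OF w'\<Omega> Suc.prems(1)] unfolding d_def by blast
  note \<eta>D = rectifiable_joinD[OF \<eta>(1)]
  \<comment> \<open>The endpoint of \<open>\<eta>\<close> nearer to \<open>z\<close> lies within
    \<open>b * d z\<close> of it, so its depth is at most
    \<open>(1 + b) * d z \<le> 2 * b * d z\<close>. The weaker endpoint bound
    \<open>r / 2 \<le> b * d w'\<close> then gives the factor 4.\<close>
  have deep: "r \<le> 4 * b\<^sup>2 * d z" if z: "z \<in> path_image \<eta>" for z
  proof -
    have bd: "b * p \<le> b * q" if "p \<le> q" for p q
      using b that by simp
    have "b * d w \<le> b * d z + b * dist w z" "b * d w' \<le> b * d z + b * dist w' z"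
      using bd[OF lip[of w z]] bd[OF lip[of w' z]] by (simp_all add: algebra_simps)
    moreover have "r \<le> b * d w"
      using Suc.prems(3) by (simp add: r_def d_def)
    moreover have "b * min (dist w' z) (dist w z) \<le> b * (b * d z)"
      using bd[OF \<eta>(3)[OF z]] .
    moreover have "b * d z \<le> b * (b * d z)"
      using b mult_right_mono[of 1 b "b * d z"] by (simp add: d_def infdist_nonneg)
    ultimately have "r \<le> 4 * (b * (b * d z))"
      using dw' r0 by (auto simp: min_def split: if_splits)
    then show ?thesis
      by (simp add: power2_eq_square mult.assoc)
  qed
  have fin: "pathfinish g = pathstart \<eta>"
    using gD \<eta>D by simp
  have "a * dist w' w \<le> a * (3/2 * r)"
    using ww' a by (intro mult_left_mono) auto
  \<comment> \<open>The two terms add up to \<open>3 * a * r\<close>, so the length constant does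
    not grow during the induction.\<close>
  then have "arclength g 0 1 + arclength \<eta> 0 1 \<le> ereal (3 * a * (r / 2)) + ereal (a * (3/2 * r))"
    using g(2) \<eta>(2) by (intro add_mono) (auto intro: order_trans)
  with arclength_joinpaths[OF fin] have total: "arclength (g +++ \<eta>) 0 1 \<le> ereal (3 * a * r)"
    by (auto intro: order_trans)
  have "arclength (g +++ \<eta>) 0 t \<le> ereal (12 * a * b\<^sup>2 * d ((g +++ \<eta>) t))" if t: "t \<in> {0..1}" for t
  proof (cases "t \<le> 1/2")
    case True
    then show ?thesis
      using order_trans[OF arclength_joinpaths_left g(3), of t \<eta>] t by (simp add: joinpaths_def)
  next
    case False
    then have "(g +++ \<eta>) t \<in> path_image \<eta>"
      using t by (auto simp: joinpaths_def path_image_def)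
    \<comment> \<open>On the last piece even the total length \<open>3 * a * r\<close> is controlled
      by the depth.\<close>
    from mult_left_mono[OF deep[OF this], of "3 * a"]
    have "3 * a * r \<le> 12 * a * b\<^sup>2 * d ((g +++ \<eta>) t)"
      using a by (simp add: mult_ac)
    then have "ereal (3 * a * r) \<le> ereal (12 * a * b\<^sup>2 * d ((g +++ \<eta>) t))"
      by simp
    moreover have "arclength (g +++ \<eta>) 0 t \<le> arclength (g +++ \<eta>) 0 1"
      using t by (intro arclength_mono_right) auto
    ultimately show ?thesis
      using total by (meson order_trans)
  qed
  moreover have "rectifiable_join \<Omega> x w (g +++ \<eta>)"
    by (rule rectifiable_joinI[OF _ _ _ _ total])
      (use fin gD \<eta>D in \<open>auto simp: path_image_join\<close>)
  ultimately show ?case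
    using total unfolding d_def r_def by blast
qed

text \<open>Since \<open>x\<close> has positive depth, some power of 2 brings \<open>w\<close> into
  the range of the halving construction; the constants do not depend on that power.\<close>

lemma length_cigar_exists:
  fixes \<Omega> :: "'a::real_normed_vector set"
  assumes "open \<Omega>" "\<Omega> \<noteq> UNIV" "1 \<le> a" "1 \<le> b" "x \<in> \<Omega>"
    and "\<And>x y. \<lbrakk>x \<in> \<Omega>; y \<in> \<Omega>; dist x y < \<delta>\<rbrakk> \<Longrightarrow>
      \<exists>\<gamma>. rectifiable_join \<Omega> x y \<gamma> \<and> arclength \<gamma> 0 1 \<le> ereal (a * dist x y) \<and>
        (\<forall>z\<in>path_image \<gamma>. min (dist x z) (dist y z) \<le> b * infdist z (frontier \<Omega>))"
    and "w \<in> \<Omega>" "3/2 * dist x w < \<delta>" "dist x w \<le> b * infdist w (frontier \<Omega>)"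
  shows "\<exists>\<gamma>. rectifiable_join \<Omega> x w \<gamma> \<and> arclength \<gamma> 0 1 \<le> ereal (3 * a * dist x w) \<and>
    (\<forall>t\<in>{0..1}. arclength \<gamma> 0 t \<le> ereal (12 * a * b\<^sup>2 * infdist (\<gamma> t) (frontier \<Omega>)))"
proof -
  define e where "e = infdist x (frontier \<Omega>) / 2"
  have e: "0 < e"
    using infdist_frontier_pos[of \<Omega> x] assms by (simp add: e_def)
  obtain k where "dist x w / e < 2 ^ k"
    using real_arch_pow[of 2 "dist x w / e"] by auto
  then have "dist x w \<le> 2 ^ k * e"
    using e by (simp add: field_simps)
  then show ?thesis
    using e unfolding e_def by (intro length_cigar_halving[OF assms(3-9)]) auto
qed

text \<open>Length cigars from \<open>x\<close> and from \<open>y\<close> to a common equidistant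
  point are glued. On each half the length measured from its own end of the curve satisfies the
  bound.\<close>

lemma locally_distance_uniform_imp_locally_uniform:
  fixes \<Omega> :: "'a::real_normed_vector set"
  assumes "open \<Omega>" "locally_distance_uniform \<Omega>"
  shows "locally_uniform \<Omega>"
proof -
  obtain a b \<delta> where ab: "1 \<le> a" "1 \<le> b" "0 < \<delta>"
    and *: "\<And>x y. \<lbrakk>x \<in> \<Omega>; y \<in> \<Omega>; dist x y < \<delta>\<rbrakk> \<Longrightarrow>
      \<exists>\<gamma>. rectifiable_join \<Omega> x y \<gamma> \<and> arclength \<gamma> 0 1 \<le> ereal (a * dist x y) \<and>
        (\<forall>z\<in>path_image \<gamma>. ereal (min (dist x z) (dist y z)) \<le> ereal b * boundary_dist \<Omega> z)"
    using assms(2) unfolding locally_distance_uniform_def by blast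
  show ?thesis
  proof (cases "\<Omega> = UNIV")
    case True
    \<comment> \<open>Without boundary the right-hand side is infinite, so the given curves already
      work.\<close>
    then have top: "p \<le> ereal b * boundary_dist \<Omega> z" for p z
      using ab by (simp add: boundary_dist_def)
    have "\<exists>\<gamma>. rectifiable_join \<Omega> x y \<gamma> \<and> arclength \<gamma> 0 1 \<le> ereal (a * dist x y) \<and>
        (\<forall>t\<in>{0..1}. min (arclength \<gamma> 0 t) (arclength \<gamma> t 1) \<le>
          ereal b * boundary_dist \<Omega> (\<gamma> t))"
      if "x \<in> \<Omega>" "y \<in> \<Omega>" "dist x y < \<delta>" for x y
      using *[OF that] top by blast
    with ab show ?thesis
      unfolding locally_uniform_def by blast
  next
    case False
    define d where "d z = infdist z (frontier \<Omega>)" for z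
    have curves: "\<exists>\<gamma>. rectifiable_join \<Omega> x y \<gamma> \<and> arclength \<gamma> 0 1 \<le> ereal (a * dist x y) \<and>
        (\<forall>z\<in>path_image \<gamma>. min (dist x z) (dist y z) \<le> b * infdist z (frontier \<Omega>))"
      if "x \<in> \<Omega>" "y \<in> \<Omega>" "dist x y < \<delta>" for x y
      using *[OF that] False ab by (simp add: ereal_le_times_boundary_dist_iff del: ereal_min)
    note cigar = length_cigar_exists[OF assms(1) False ab(1,2) _ curves]
    define C where "C = 12 * a * b\<^sup>2"
    have C: "1 \<le> C"
      using ab mult_mono[of 1 "12 * a" 1 "b\<^sup>2"] by (simp add: C_def)
    have "\<exists>\<gamma>. rectifiable_join \<Omega> x y \<gamma> \<and> arclength \<gamma> 0 1 \<le> ereal (6 * a\<^sup>2 * dist x y) \<and>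
        (\<forall>t\<in>{0..1}. min (arclength \<gamma> 0 t) (arclength \<gamma> t 1) \<le>
          ereal C * boundary_dist \<Omega> (\<gamma> t))"
      if x: "x \<in> \<Omega>" and y: "y \<in> \<Omega>" and xy: "dist x y < \<delta> / (2 * a)" for x y
    proof -
      \<comment> \<open>The radius \<open>\<delta> / (2 * a)\<close> is chosen so that
        \<open>r \<le> a * dist x y\<close> below yields \<open>3/2 * r < \<delta>\<close>, as the
        cigars require.\<close>
      have axy: "a * dist x y < \<delta> / 2"
        using xy ab by (simp add: field_simps)
      have "dist x y \<le> a * dist x y"
        using ab mult_right_mono[of 1 a "dist x y"] by simp
      then have "dist x y < \<delta>"
        using axy ab by linarith
      then obtain \<sigma> where \<sigma>: "rectifiable_join \<Omega> x y \<sigma>" "arclength \<sigma> 0 1 \<le> ereal (a * dist x y)"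
        "\<And>z. z \<in> path_image \<sigma> \<Longrightarrow> min (dist x z) (dist y z) \<le> b * d z"
        using curves[OF x y] unfolding d_def by blast
      note \<sigma>D = rectifiable_joinD[OF \<sigma>(1)]
      obtain w where w: "w \<in> path_image \<sigma>" "dist x w = dist y w"
      proof -
        have "continuous_on {0..1} (\<lambda>t. dist x (\<sigma> t) - dist y (\<sigma> t))"
          using \<sigma>D(1) by (intro continuous_intros) (simp_all add: path_def)
        then obtain t where "0 \<le> t" "t \<le> 1" "dist x (\<sigma> t) - dist y (\<sigma> t) = 0"
          using IVT'[of "\<lambda>t. dist x (\<sigma> t) - dist y (\<sigma> t)" 0 0 1] \<sigma>D(3,4)
          by (auto simp: pathstart_def pathfinish_def)
        then show thesis
          by (intro that[of "\<sigma> t"]) (auto simp: path_image_def)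
      qed
      define r where "r = dist x w"
      have r: "r \<le> a * dist x y" "dist y w = r" "0 \<le> r"
        using dist_add_dist_le[OF \<sigma>(1,2) w(1)] w(2) zero_le_dist[of x w]
        unfolding r_def dist_commute[of w y] by linarith+
      have w\<Omega>: "w \<in> \<Omega>"
        using w \<sigma>D by blast
      have dw: "r \<le> b * d w"
        using \<sigma>(3)[OF w(1)] w(2) by (simp add: r_def)
      have r\<delta>: "3/2 * r < \<delta>"
        using r axy ab by linarith
      obtain g where g: "rectifiable_join \<Omega> x w g" "arclength g 0 1 \<le> ereal (3 * a * r)"
        "\<And>t. t \<in> {0..1} \<Longrightarrow> arclength g 0 t \<le> ereal (C * d (g t))"
        using cigar[OF x _ _ _ w\<Omega>] r\<delta> dw unfolding C_def d_def r_def by blast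
      obtain h where h: "rectifiable_join \<Omega> y w h" "arclength h 0 1 \<le> ereal (3 * a * r)"
        "\<And>t. t \<in> {0..1} \<Longrightarrow> arclength h 0 t \<le> ereal (C * d (h t))"
        using cigar[OF y _ _ _ w\<Omega>] r\<delta> dw unfolding C_def d_def r(2) by blast
      note gD = rectifiable_joinD[OF g(1)] and hD = rectifiable_joinD[OF h(1)]
      define \<gamma> where "\<gamma> = g +++ reversepath h"
      have fin: "pathfinish g = pathstart (reversepath h)"
        using gD hD by simp
      have "arclength (reversepath h) 0 1 \<le> ereal (3 * a * r)"
        using arclength_reversepath_le[of h 0 1] h(2) by (auto intro: order_trans)
      then have "arclength g 0 1 + arclength (reversepath h) 0 1 \<le>
          ereal (3 * a * r) + ereal (3 * a * r)"
        using g(2) by (intro add_mono)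
      with arclength_joinpaths[OF fin] have "arclength \<gamma> 0 1 \<le> ereal (6 * a * r)"
        unfolding \<gamma>_def by (auto intro: order_trans)
      \<comment> \<open>The second factor \<open>a\<close> comes from the bound on \<open>r\<close>
        in terms of \<open>dist x y\<close>.\<close>
      moreover have "6 * a * r \<le> 6 * a\<^sup>2 * dist x y"
        using mult_left_mono[OF r(1), of "6 * a"] ab by (simp add: power2_eq_square mult_ac)
      ultimately have total: "arclength \<gamma> 0 1 \<le> ereal (6 * a\<^sup>2 * dist x y)"
        by (auto intro: order_trans)
      have bd: "ereal C * boundary_dist \<Omega> z = ereal (C * d z)" for z
        using False by (simp add: boundary_dist_def d_def)
      have "min (arclength \<gamma> 0 t) (arclength \<gamma> t 1) \<le> ereal C * boundary_dist \<Omega> (\<gamma> t)"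
        if t: "t \<in> {0..1}" for t
      proof (cases "t \<le> 1/2")
        case True
        then have "arclength \<gamma> 0 t \<le> ereal (C * d (\<gamma> t))"
          unfolding \<gamma>_def
          using order_trans[OF arclength_joinpaths_left g(3), of t "reversepath h"] t
          by (simp add: joinpaths_def)
        then show ?thesis
          unfolding bd by (rule min.coboundedI1)
      next
        case False
        \<comment> \<open>The portion from \<open>\<gamma> t\<close> to \<open>y\<close>, read
          backwards, is an initial portion of \<open>h\<close>, ending at the parameter
          \<open>1 - (2 * t - 1)\<close>.\<close>
        then have "arclength \<gamma> t 1 \<le> arclength (reversepath h) (2 * t - 1) 1"
          unfolding \<gamma>_def using t by (intro arclength_joinpaths_right[OF fin]) auto
        also have "\<dots> \<le> arclength h 0 (2 - 2 * t)"
          using arclength_reversepath_le[of h "2 * t - 1" 1] by simp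
        also have "\<dots> \<le> ereal (C * d (h (2 - 2 * t)))"
          using t False by (intro h(3)) auto
        also have "h (2 - 2 * t) = \<gamma> t"
          using False by (simp add: \<gamma>_def joinpaths_def reversepath_def)
        finally show ?thesis
          unfolding bd by (rule min.coboundedI2)
      qed
      moreover have "rectifiable_join \<Omega> x y \<gamma>"
        by (rule rectifiable_joinI[OF _ _ _ _ total])
          (use fin gD hD in \<open>auto simp: \<gamma>_def path_image_join\<close>)
      ultimately show ?thesis
        using total by blast
    qed
    moreover have "1 \<le> 6 * a\<^sup>2" "0 < \<delta> / (2 * a)"
      using ab one_le_power[OF ab(1), of 2] by (linarith, simp)
    ultimately show ?thesis
      unfolding locally_uniform_def using C by blast
  qed
qed

text \<open>A chord is no longer than its arc, so the same curves and constants serve.\<close>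

lemma locally_uniform_imp_locally_distance_uniform:
  assumes "locally_uniform \<Omega>"
  shows "locally_distance_uniform \<Omega>"
proof -
  obtain a b \<delta> where ab: "1 \<le> a" "1 \<le> b" "0 < \<delta>"
    and *: "\<And>x y. \<lbrakk>x \<in> \<Omega>; y \<in> \<Omega>; dist x y < \<delta>\<rbrakk> \<Longrightarrow>
      \<exists>\<gamma>. rectifiable_join \<Omega> x y \<gamma> \<and> arclength \<gamma> 0 1 \<le> ereal (a * dist x y) \<and>
        (\<forall>t\<in>{0..1}. min (arclength \<gamma> 0 t) (arclength \<gamma> t 1) \<le>
          ereal b * boundary_dist \<Omega> (\<gamma> t))"
    using assms unfolding locally_uniform_def by blast
  have "\<exists>\<gamma>. rectifiable_join \<Omega> x y \<gamma> \<and> arclength \<gamma> 0 1 \<le> ereal (a * dist x y) \<and>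
        (\<forall>z\<in>path_image \<gamma>. ereal (min (dist x z) (dist y z)) \<le> ereal b * boundary_dist \<Omega> z)"
    if xy: "x \<in> \<Omega>" "y \<in> \<Omega>" "dist x y < \<delta>" for x y
  proof -
    obtain \<gamma> where \<gamma>: "rectifiable_join \<Omega> x y \<gamma>" "arclength \<gamma> 0 1 \<le> ereal (a * dist x y)"
      "\<And>t. t \<in> {0..1} \<Longrightarrow> min (arclength \<gamma> 0 t) (arclength \<gamma> t 1) \<le>
          ereal b * boundary_dist \<Omega> (\<gamma> t)"
      using *[OF xy] by blast
    have "ereal (min (dist x z) (dist y z)) \<le> ereal b * boundary_dist \<Omega> z"
      if "z \<in> path_image \<gamma>" for z
    proof -
      obtain t where t: "t \<in> {0..1}" "z = \<gamma> t"
        using \<open>z \<in> path_image \<gamma>\<close> by (auto simp: path_image_def)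
      have "ereal (dist x z) \<le> arclength \<gamma> 0 t" "ereal (dist y z) \<le> arclength \<gamma> t 1"
        using dist_le_arclength[of 0 t \<gamma>] dist_le_arclength[of t 1 \<gamma>] t
          rectifiable_joinD(3,4)[OF \<gamma>(1)]
        by (auto simp: pathstart_def pathfinish_def dist_commute)
      then have "min (ereal (dist x z)) (ereal (dist y z)) \<le>
          min (arclength \<gamma> 0 t) (arclength \<gamma> t 1)"
        by (rule min.mono)
      also have "\<dots> \<le> ereal b * boundary_dist \<Omega> z"
        using \<gamma>(3)[OF t(1)] t(2) by simp
      finally show ?thesis
        by simp
    qed
    with \<gamma> show ?thesis
      by blast
  qed
  with ab show ?thesis
    unfolding locally_distance_uniform_def by blast
qed

section \<open>The cigar condition of \<open>(\<epsilon>, \<delta>)\<close>-domains\<close>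

text \<open>The larger of the distances from \<open>z\<close> to \<open>x\<close> and
  \<open>y\<close> is at least \<open>dist x y / 2\<close>; cancelling it from the product leaves
  the smaller one, at the cost of the factor 2 in \<open>2 / \<epsilon>\<close>.\<close>

lemma eps_delta_domain_imp_locally_distance_uniform:
  assumes "eps_delta_domain \<epsilon> \<delta> \<Omega>" "0 < \<epsilon>" "0 < \<delta>"
  shows "locally_distance_uniform \<Omega>"
proof -
  define a b where "a = max 1 (inverse \<epsilon>)" and "b = max 1 (2 / \<epsilon>)"
  have ab: "1 \<le> a" "1 \<le> b" "inverse \<epsilon> \<le> a" "2 / \<epsilon> \<le> b"
    by (auto simp: a_def b_def)
  have "\<exists>\<gamma>. rectifiable_join \<Omega> x y \<gamma> \<and> arclength \<gamma> 0 1 \<le> ereal (a * dist x y) \<and>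
        (\<forall>z\<in>path_image \<gamma>. ereal (min (dist x z) (dist y z)) \<le> ereal b * boundary_dist \<Omega> z)"
    if xy: "x \<in> \<Omega>" "y \<in> \<Omega>" "dist x y < \<delta>" for x y
  proof (cases "x = y")
    case True
    have "0 \<le> ereal b * boundary_dist \<Omega> x"
      using ab boundary_dist_nonneg[of \<Omega> x] by simp
    then show ?thesis
      using rectifiable_join_const[OF xy(1)] True
      by (intro exI[of _ "\<lambda>_. x"]) (auto simp: path_image_def zero_ereal_def)
  next
    case False
    obtain \<gamma> where \<gamma>: "rectifiable_join \<Omega> x y \<gamma>"
      "arclength \<gamma> 0 1 \<le> ereal (inverse \<epsilon> * dist x y)"
      "\<And>z. z \<in> path_image \<gamma> \<Longrightarrow>
        ereal (\<epsilon> * (dist z x * dist z y / dist x y)) \<le> boundary_dist \<Omega> z"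
      using assms(1) xy False unfolding eps_delta_domain_def by blast
    have "inverse \<epsilon> * dist x y \<le> a * dist x y"
      using ab by (intro mult_right_mono) auto
    then have "arclength \<gamma> 0 1 \<le> ereal (a * dist x y)"
      using \<gamma>(2) by (auto intro: order_trans)
    moreover have "ereal (min (dist x z) (dist y z)) \<le> ereal b * boundary_dist \<Omega> z"
      if z: "z \<in> path_image \<gamma>" for z
    proof -
      let ?m = "min (dist x z) (dist y z)" and ?M = "max (dist x z) (dist y z)"
      have "dist x y \<le> 2 * ?M"
        using dist_triangle[of x y z] by (auto simp: dist_commute)
      then have "?m * dist x y \<le> ?m * (2 * ?M)"
        by (intro mult_left_mono) auto
      also have "\<dots> = 2 * (dist z x * dist z y)"
        by (auto simp: min_def max_def dist_commute)
      finally have "?m \<le> 2 / \<epsilon> * (\<epsilon> * (dist z x * dist z y / dist x y))"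
        using False assms(2) by (simp add: field_simps)
      also have "\<dots> \<le> b * (\<epsilon> * (dist z x * dist z y / dist x y))"
        using ab assms(2) by (intro mult_right_mono) auto
      finally have "ereal ?m \<le> ereal b * ereal (\<epsilon> * (dist z x * dist z y / dist x y))"
        by (simp only: times_ereal.simps ereal_less_eq(3))
      also have "\<dots> \<le> ereal b * boundary_dist \<Omega> z"
        using \<gamma>(3)[OF z] ab by (intro ereal_mult_left_mono) auto
      finally show ?thesis .
    qed
    ultimately show ?thesis
      using \<gamma>(1) by blast
  qed
  with ab assms(3) show ?thesis
    unfolding locally_distance_uniform_def by blast
qed

text \<open>The length bound keeps the larger distance below \<open>a * dist x y\<close>, and the
  smaller one is at most \<open>b\<close> times the depth, so the product is controlled.\<close>

lemma locally_distance_uniform_imp_eps_delta_domain: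
  assumes "locally_distance_uniform \<Omega>"
  obtains \<epsilon> \<delta> where "0 < \<epsilon>" "0 < \<delta>" "eps_delta_domain \<epsilon> \<delta> \<Omega>"
proof -
  obtain a b \<delta> where ab: "1 \<le> a" "1 \<le> b" "0 < \<delta>"
    and *: "\<And>x y. \<lbrakk>x \<in> \<Omega>; y \<in> \<Omega>; dist x y < \<delta>\<rbrakk> \<Longrightarrow>
      \<exists>\<gamma>. rectifiable_join \<Omega> x y \<gamma> \<and> arclength \<gamma> 0 1 \<le> ereal (a * dist x y) \<and>
        (\<forall>z\<in>path_image \<gamma>. ereal (min (dist x z) (dist y z)) \<le> ereal b * boundary_dist \<Omega> z)"
    using assms unfolding locally_distance_uniform_def by blast
  \<comment> \<open>The product bound needs \<open>a * b\<close>; since \<open>b \<ge> 1\<close>,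
    the length bound \<open>a \<le> inverse \<epsilon>\<close> follows too.\<close>
  define \<epsilon> where "\<epsilon> = inverse (a * b)"
  have "\<exists>\<gamma>. rectifiable_join \<Omega> x y \<gamma> \<and> arclength \<gamma> 0 1 \<le> ereal (inverse \<epsilon> * dist x y) \<and>
        (\<forall>z\<in>path_image \<gamma>.
          ereal (\<epsilon> * (dist z x * dist z y / dist x y)) \<le> boundary_dist \<Omega> z)"
    if xy: "x \<in> \<Omega>" "y \<in> \<Omega>" "x \<noteq> y" "dist x y < \<delta>" for x y
  proof -
    obtain \<gamma> where \<gamma>: "rectifiable_join \<Omega> x y \<gamma>" "arclength \<gamma> 0 1 \<le> ereal (a * dist x y)"
      "\<And>z. z \<in> path_image \<gamma> \<Longrightarrow>
        ereal (min (dist x z) (dist y z)) \<le> ereal b * boundary_dist \<Omega> z"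
      using *[OF xy(1,2,4)] by blast
    have "a * dist x y \<le> inverse \<epsilon> * dist x y"
      using ab mult_left_mono[of 1 b a] by (intro mult_right_mono) (auto simp: \<epsilon>_def)
    then have "arclength \<gamma> 0 1 \<le> ereal (inverse \<epsilon> * dist x y)"
      using \<gamma>(2) by (auto intro: order_trans)
    moreover have "ereal (\<epsilon> * (dist z x * dist z y / dist x y)) \<le> boundary_dist \<Omega> z"
      if z: "z \<in> path_image \<gamma>" for z
    proof (cases "\<Omega> = UNIV")
      case True
      then show ?thesis
        by (simp add: ereal_le_boundary_dist_iff)
    next
      case False
      define m M where "m = min (dist x z) (dist y z)" and "M = max (dist x z) (dist y z)"
      have "M \<le> a * dist x y"
        using dist_add_dist_le[OF \<gamma>(1,2) z] zero_le_dist[of x z] zero_le_dist[of z y]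
        unfolding M_def dist_commute[of y z] by linarith
      then have "m * M \<le> m * (a * dist x y)"
        by (intro mult_left_mono) (auto simp: m_def)
      also have "m * M = dist z x * dist z y"
        by (auto simp: m_def M_def min_def max_def dist_commute)
      finally have "\<epsilon> * (dist z x * dist z y / dist x y) \<le> m / b"
        using xy(3) ab by (simp add: \<epsilon>_def field_simps)
      also have "\<dots> \<le> infdist z (frontier \<Omega>)"
        using \<gamma>(3)[OF z] False ab by (simp add: ereal_le_times_boundary_dist_iff m_def field_simps del: ereal_min)
      finally show ?thesis
        by (simp add: ereal_le_boundary_dist_iff)
    qed
    ultimately show ?thesis
      using \<gamma>(1) by blast
  qed
  then have "eps_delta_domain \<epsilon> \<delta> \<Omega>"
    unfolding eps_delta_domain_def by blast
  moreover have "0 < \<epsilon>"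
    using ab by (simp add: \<epsilon>_def)
  ultimately show thesis
    using that ab(3) by blast
qed

theorem theorem2p8:
  fixes \<Omega> :: "(real ^ 'n) set"
  assumes "\<Omega> \<noteq> {}" and "open \<Omega>" and "connected \<Omega>"
  shows "((\<exists>\<epsilon>>0. \<exists>\<delta>>0. eps_delta_domain \<epsilon> \<delta> \<Omega>) \<longleftrightarrow> locally_distance_uniform \<Omega>) \<and>
    (locally_distance_uniform \<Omega> \<longleftrightarrow> locally_uniform \<Omega>)"
  using eps_delta_domain_imp_locally_distance_uniform[of _ _ \<Omega>]
    locally_distance_uniform_imp_eps_delta_domain[of \<Omega>]
    locally_distance_uniform_imp_locally_uniform[OF assms(2)]
    locally_uniform_imp_locally_distance_uniform[of \<Omega>]
  by metis

end
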